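(* Let $P=\{P_1,\dots,P_n\}$, $n\ge 2$, be a finite system of polyominoes placed in the plane in a grid-aligned configuration with pairwise disjoint interiors, such that each $P_i$ consists of five or fewer unit squares. Then $P$ is not interlocked.
   Context: A polyomino is a polygon with integer side lengths and only right angles that can be created by joining finitely many unit squares along edges. A configuration of polyominoes is grid-aligned if every constituent unit square of every polyomino is a cell of the integer grid $\mathbb{Z}^2$, and distinct polyominoes do not overlap (their interiors are disjoint; they may touch along their boundaries). A motion of a system $P=\{P_1,\dots,P_n\}$ is a choice of continuous maps $g_i:[0,1]\to SE(2)$ (orientation-preserving rigid motions of the plane), $i=1,\dots,n$, with $g_i(0)=\mathrm{id}$, such that for every $t\in[0,1]$ the sets $g_1(t)P_1,\dots,g_n(t)P_n$ have pairwise disjoint interiors. Arbitrary translations, rotations through arbitrary angles, and simultaneous movement of several pieces are allowed; pieces need not stay grid-aligned during the motion. The system, starting in a grid-aligned configuration, is interlocked if no nonempty proper subset of its polyominoes can be separated arbitrarily far from the rest by a motion. That is, it is not interlocked if there is a nonempty proper subset $S\subset\{1,\dots,n\}$ such that for every $R>0$ there is a motion at whose end each $g_i(1)P_i$ with $i\in S$ is at distance at least $R$ from each $g_j(1)P_j$ with $j\notin S$. *)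

theory Defs
  imports "HOL-Analysis.Analysis"
begin

definition unit_cell :: "int \<times> int \<Rightarrow> (real^2) set" where
  "unit_cell c = cbox (vector [of_int (fst c), of_int (snd c)])
                      (vector [of_int (fst c) + 1, of_int (snd c) + 1])"

definition edge_adjacent :: "int \<times> int \<Rightarrow> int \<times> int \<Rightarrow> bool" where
  "edge_adjacent c d \<longleftrightarrow> \<bar>fst c - fst d\<bar> + \<bar>snd c - snd d\<bar> = 1"

text \<open>A grid-aligned polyomino is represented by its set of constituent grid cells; the
  polygon itself is the closed plane region \<open>region C\<close>. Holes are not excluded, but an
  edge-connected set of at most five cells has none and its region is a simple polygon.\<close>

definition polyomino :: "(int \<times> int) set \<Rightarrow> bool" where
  "polyomino C \<longleftrightarrow> finite C \<and> C \<noteq> {} \<and>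
     (\<forall>c\<in>C. \<forall>d\<in>C. (c, d) \<in> {(a, b). a \<in> C \<and> b \<in> C \<and> edge_adjacent a b}\<^sup>*)"

definition region :: "(int \<times> int) set \<Rightarrow> (real^2) set" where
  "region C = (\<Union>c\<in>C. unit_cell c)"

definition disjoint_interiors :: "'i set \<Rightarrow> ('i \<Rightarrow> (real^2) set) \<Rightarrow> bool" where
  "disjoint_interiors I X \<longleftrightarrow> pairwise (\<lambda>i j. interior (X i) \<inter> interior (X j) = {}) I"

definition grid_aligned_configuration :: "'i set \<Rightarrow> ('i \<Rightarrow> (int \<times> int) set) \<Rightarrow> bool" where
  "grid_aligned_configuration I P \<longleftrightarrow>
     (\<forall>i\<in>I. polyomino (P i)) \<and> disjoint_interiors I (\<lambda>i. region (P i))"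

text \<open>The pair \<open>(A, b)\<close> stands for the rigid motion \<open>x \<mapsto> A x + b\<close>; the product topology on
  pairs induces the usual topology of \<open>SE(2)\<close>.\<close>

type_synonym affine2 = "(real^2^2) \<times> (real^2)"

definition SE2 :: "affine2 set" where
  "SE2 = {(A, b). rotation_matrix A}"

definition act :: "affine2 \<Rightarrow> real^2 \<Rightarrow> real^2" where
  "act g x = fst g *v x + snd g"

definition motion ::
    "'i set \<Rightarrow> ('i \<Rightarrow> (real^2) set) \<Rightarrow> ('i \<Rightarrow> real \<Rightarrow> affine2) \<Rightarrow> bool" where
  "motion I X g \<longleftrightarrow>
     (\<forall>i\<in>I. continuous_on {0..1} (g i) \<and> g i ` {0..1} \<subseteq> SE2 \<and> g i 0 = (mat 1, 0)) \<and>
     (\<forall>t\<in>{0..1}. disjoint_interiors I (\<lambda>i. act (g i t) ` X i))"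

definition separable :: "'i set \<Rightarrow> ('i \<Rightarrow> (real^2) set) \<Rightarrow> 'i set \<Rightarrow> bool" where
  "separable I X S \<longleftrightarrow>
     (\<forall>R>0. \<exists>g. motion I X g \<and>
        (\<forall>i\<in>S. \<forall>j\<in>I - S. R \<le> setdist (act (g i 1) ` X i) (act (g j 1) ` X j)))"

definition interlocked :: "'i set \<Rightarrow> ('i \<Rightarrow> (real^2) set) \<Rightarrow> bool" where
  "interlocked I X \<longleftrightarrow> \<not> (\<exists>S. S \<noteq> {} \<and> S \<subset> I \<and> separable I X S)"

end

theory Submission
  imports Defs
begin

text \<open>
  A translation parallel to one coordinate axis already separates every such system.

  A set of pieces can be slid away to the right as soon as no piece outside it has a cell to
  the right of one of its cells in the same row (\<open>separable_by_sliding\<close>). Disjoint pieces that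
  are connected and meet every row in an interval can be ordered from left to right without
  cycles, so one of them has nothing to its right (\<open>exists_rightmost\<close>). The same holds for
  columns and upward slides.

  With at most five cells, the only polyomino that misses a cell between two cells of some row
  is the upright or inverted U pentomino, which misses the single cell of its cavity
  (\<open>row_gap_imp_u_shape\<close>). If no piece has a gap in a column, sliding one piece upwards is
  enough. Otherwise some piece is a U lying on its side, and the slide is horizontal. An upright
  or inverted U blocks, and is blocked by, the piece that plugs its cavity, so the two have to
  move together. Each U is therefore clustered with its plug, and the cavities are filled. The
  resulting blocks again meet every row in an interval (\<open>block_row_convex\<close>), because a plug
  enters a U only through its mouth and has too few cells to come around to its back
  (\<open>plug_stays_outside\<close>). So some cluster has nothing to its right. A U lying on its side
  neither fits into another cavity nor has a cavity between cells of one row. Hence it is alone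
  in its cluster (\<open>column_gap_not_in_cluster\<close>), and no cluster is the whole system.
\<close>

section \<open>Sliding in an axis direction\<close>

definition coord :: "int \<times> int \<Rightarrow> 2 \<Rightarrow> int" where
  "coord c l = (if l = 1 then fst c else snd c)"

lemma mem_unit_cell_iff:
  "x \<in> unit_cell c \<longleftrightarrow> (\<forall>l. of_int (coord c l) \<le> x $ l \<and> x $ l \<le> of_int (coord c l) + 1)"
  by (auto simp: unit_cell_def mem_box_cart forall_2 coord_def)

lemma interior_unit_cell_nonempty: "interior (unit_cell c) \<noteq> {}"
proof -
  have "vector [of_int (fst c) + 1/2, of_int (snd c) + 1/2] \<in>
      box (vector [of_int (fst c), of_int (snd c)] :: real^2)
        (vector [of_int (fst c) + 1, of_int (snd c) + 1])"
    by (auto simp: mem_box_cart forall_2)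
  then show ?thesis
    unfolding unit_cell_def interior_cbox by blast
qed

lemma disjoint_cells_if_disjoint_interiors:
  assumes "interior (region A) \<inter> interior (region B) = {}"
  shows "A \<inter> B = {}"
proof (rule ccontr)
  assume "A \<inter> B \<noteq> {}"
  then obtain c where "c \<in> A" "c \<in> B" by blast
  then have "unit_cell c \<subseteq> region A" "unit_cell c \<subseteq> region B"
    by (auto simp: region_def)
  then have "interior (unit_cell c) \<subseteq> interior (region A) \<inter> interior (region B)"
    by (simp add: interior_mono)
  with assms interior_unit_cell_nonempty show False by blast
qed

text \<open>The interior of a union of cells also contains points on common edges of cells. Testing
  overlap at points off the grid lines avoids these: along a diagonal through \<open>x\<close> only countably
  many points lie on a grid line.\<close>

lemma open_contains_nonintegral_point:
  fixes U :: "(real^2) set"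
  assumes "open U" "x \<in> U"
  obtains y where "y \<in> U" "\<And>l. y $ l \<notin> \<int>"
proof -
  define f where "f = (\<lambda>\<delta>::real. x + \<delta> *\<^sub>R 1)"
  define N where "N = (\<Union>l. (\<lambda>z. of_int z - x $ l) ` (UNIV :: int set))"
  have "open (f -` U)"
    unfolding f_def by (intro open_vimage assms continuous_intros)
  moreover have "f -` U \<noteq> {}"
  proof -
    have "0 \<in> f -` U" using assms(2) by (simp add: f_def)
    then show ?thesis by blast
  qed
  moreover have "countable N"
    by (auto simp: N_def intro!: countable_UN countable_finite)
  ultimately obtain \<delta> where d: "\<delta> \<in> f -` U" "\<delta> \<notin> N"
    using open_minus_countable by metis
  have "f \<delta> $ l \<notin> \<int>" for l
  proof
    assume "f \<delta> $ l \<in> \<int>"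
    then obtain z where "f \<delta> $ l = of_int z" by (auto elim: Ints_cases)
    then have "\<delta> = of_int z - x $ l" by (simp add: f_def)
    with d(2) show False by (auto simp: N_def)
  qed
  with d(1) that show ?thesis by auto
qed

text \<open>If the two interiors met after the slide, they would meet at a point off the grid lines.
  This point lies in exactly one cell of the grid, a cell \<open>d\<close> of \<open>B\<close>, and in a translate of a cell
  \<open>c\<close> of \<open>A\<close>. Then \<open>c\<close> and \<open>d\<close> lie on one line in direction \<open>k\<close>, with \<open>c\<close> not ahead of \<open>d\<close>.\<close>

lemma sliding_keeps_interiors_disjoint:
  fixes k :: 2
  assumes ahead: "\<And>c d. c \<in> A \<Longrightarrow> d \<in> B \<Longrightarrow> (\<And>l. l \<noteq> k \<Longrightarrow> coord c l = coord d l) \<Longrightarrow>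
      coord d k < coord c k"
    and "0 \<le> t"
  shows "interior ((+) (t *\<^sub>R axis k 1) ` region A) \<inter> interior (region B) = {}"
proof (rule ccontr)
  let ?U = "interior ((+) (t *\<^sub>R axis k 1) ` region A) \<inter> interior (region B)"
  assume "?U \<noteq> {}"
  then obtain x where "x \<in> ?U" by blast
  then obtain y where y: "y \<in> ?U" and nonint: "\<And>l. y $ l \<notin> \<int>"
    using open_contains_nonintegral_point[of ?U x] by blast
  from y have yB: "y \<in> region B" and yA: "y \<in> (+) (t *\<^sub>R axis k 1) ` region A"
    using interior_subset by blast+
  from yB obtain d where d: "d \<in> B" "y \<in> unit_cell d"
    by (auto simp: region_def)
  from yA obtain z c where c: "c \<in> A" "z \<in> unit_cell c" "y = t *\<^sub>R axis k 1 + z"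
    by (auto simp: region_def)
  have strict: "y $ l < of_int (coord d l) + 1" "of_int (coord d l) < y $ l" for l
    using d(2) nonint[of l] unfolding mem_unit_cell_iff
    by (metis Ints_1 Ints_add Ints_of_int less_eq_real_def)+
  have "coord c l = coord d l" if "l \<noteq> k" for l
  proof -
    have "y $ l = z $ l" using c(3) that by (simp add: axis_def)
    then have "of_int (coord c l) \<le> y $ l" "y $ l \<le> of_int (coord c l) + 1"
      using c(2) by (auto simp: mem_unit_cell_iff)
    with strict[of l] show ?thesis by linarith
  qed
  then have "coord d k < coord c k" using ahead c(1) d(1) by blast
  moreover have "of_int (coord c k) \<le> z $ k" "y $ k = t + z $ k"
    using c(2,3) by (auto simp: mem_unit_cell_iff axis_def)
  ultimately show False using strict[of k] \<open>0 \<le> t\<close> by linarith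
qed

lemma act_identity_rotation: "act (mat 1, v) ` X = (+) v ` X"
  by (auto simp: act_def add.commute)

lemma rotation_matrix_mat_1: "rotation_matrix (mat 1 :: real^2^2)"
  by (simp add: rotation_matrix_def orthogonal_matrix_id)

lemma separable_by_sliding:
  fixes k :: 2 and P :: "'i \<Rightarrow> (int \<times> int) set"
  assumes "finite I" "\<And>i. i \<in> I \<Longrightarrow> finite (P i)" "\<And>i. i \<in> I \<Longrightarrow> P i \<noteq> {}"
    and disj: "disjoint_interiors I (\<lambda>i. region (P i))"
    and "S \<subseteq> I"
    and unblocked: "\<And>i j c d. i \<in> S \<Longrightarrow> j \<in> I - S \<Longrightarrow> c \<in> P i \<Longrightarrow> d \<in> P j \<Longrightarrow>
      (\<And>l. l \<noteq> k \<Longrightarrow> coord c l = coord d l) \<Longrightarrow> \<not> coord c k < coord d k"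
  shows "separable I (\<lambda>i. region (P i)) S"
  unfolding separable_def
proof (intro allI impI)
  fix R :: real assume "R > 0"
  have "compact (region (P i))" if "i \<in> I" for i
    unfolding region_def using assms(2)[OF that]
    by (intro compact_UN) (auto simp: unit_cell_def)
  then have "bounded (\<Union>i\<in>I. region (P i))"
    using \<open>finite I\<close> by (intro bounded_UN ballI compact_imp_bounded)
  then obtain M where "M > 0" and M: "\<And>i x. i \<in> I \<Longrightarrow> x \<in> region (P i) \<Longrightarrow> norm x \<le> M"
    unfolding bounded_pos by blast
  \<comment> \<open>All pieces lie within distance \<open>M\<close> of the origin, so a shift by \<open>R + 2 * M\<close> leaves a gap of at
     least \<open>R\<close> in direction \<open>k\<close>.\<close>
  define L where "L = R + 2 * M"
  have "L > 0" using \<open>R > 0\<close> \<open>M > 0\<close> by (simp add: L_def)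
  define v where "v = (\<lambda>i t. if i \<in> S then (t * L) *\<^sub>R axis k 1 else 0 :: real^2)"
  define g where "g = (\<lambda>i t. (mat 1 :: real^2^2, v i t))"
  have slide: "interior ((+) (v i t) ` region (P i)) \<inter> interior ((+) (v j t) ` region (P j)) = {}"
    if "i \<in> S" "j \<in> I - S" "t \<in> {0..1}" for i j t
  proof -
    have "P i \<inter> P j = {}"
      using pairwiseD[OF disj[unfolded disjoint_interiors_def], of i j] that \<open>S \<subseteq> I\<close>
      by (intro disjoint_cells_if_disjoint_interiors) blast
    have "coord d k < coord c k"
      if *: "c \<in> P i" "d \<in> P j" "\<And>l. l \<noteq> k \<Longrightarrow> coord c l = coord d l" for c d
    proof -
      have "c \<noteq> d" using * \<open>P i \<inter> P j = {}\<close> by blast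
      then obtain l where "coord c l \<noteq> coord d l"
        by (metis coord_def prod.expand zero_neq_one)
      then have "coord c k \<noteq> coord d k" using *(3) by metis
      moreover have "\<not> coord c k < coord d k"
        using unblocked[OF \<open>i \<in> S\<close> \<open>j \<in> I - S\<close>] * by blast
      ultimately show ?thesis by linarith
    qed
    then show ?thesis
      using sliding_keeps_interiors_disjoint[of "P i" "P j" k "t * L"] that \<open>L > 0\<close>
      by (simp add: v_def)
  qed
  have "disjoint_interiors I (\<lambda>i. act (g i t) ` region (P i))" if "t \<in> {0..1}" for t
    unfolding disjoint_interiors_def
  proof (rule pairwiseI)
    fix i j assume ij: "i \<in> I" "j \<in> I" "i \<noteq> j"
    then have start: "interior (region (P i)) \<inter> interior (region (P j)) = {}"
      using disj by (auto simp: disjoint_interiors_def pairwise_def)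
    have "v i t = v j t" if "(i \<in> S) = (j \<in> S)"
      using that by (simp add: v_def)
    then consider "i \<in> S" "j \<notin> S" | "i \<notin> S" "j \<in> S" | "v i t = v j t"
      by blast
    then show "interior (act (g i t) ` region (P i)) \<inter> interior (act (g j t) ` region (P j)) = {}"
    proof cases
      case 1
      then show ?thesis using slide[of i j t] ij that by (simp add: g_def act_identity_rotation)
    next
      case 2
      then show ?thesis using slide[of j i t] ij that
        by (simp add: g_def act_identity_rotation Int_commute)
    next
      case 3
      then show ?thesis using start
        by (simp add: g_def act_identity_rotation interior_translation flip: image_Int)
    qed
  qed
  moreover have "continuous_on {0..1} (g i)" for i
    unfolding g_def v_def by (cases "i \<in> S") (simp_all, intro continuous_intros)
  ultimately have "motion I (\<lambda>i. region (P i)) g"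
    unfolding motion_def SE2_def
    by (auto simp: g_def v_def rotation_matrix_mat_1)
  moreover have "R \<le> setdist (act (g i 1) ` region (P i)) (act (g j 1) ` region (P j))"
    if "i \<in> S" "j \<in> I - S" for i j
  proof (rule le_setdistI)
    have "unit_cell c \<noteq> {}" for c
      using interior_unit_cell_nonempty[of c] interior_subset by blast
    then have "region (P m) \<noteq> {}" if "m \<in> I" for m
      using assms(3)[OF that] by (auto simp: region_def)
    then show "act (g i 1) ` region (P i) \<noteq> {}" "act (g j 1) ` region (P j) \<noteq> {}"
      using that \<open>S \<subseteq> I\<close> by auto
  next
    fix x y assume "x \<in> act (g i 1) ` region (P i)" "y \<in> act (g j 1) ` region (P j)"
    moreover have "v i 1 = L *\<^sub>R axis k 1" "v j 1 = 0" using that by (simp_all add: v_def)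
    ultimately obtain x' where x': "x' \<in> region (P i)" "x = L *\<^sub>R axis k 1 + x'"
      and y: "y \<in> region (P j)"
      by (auto simp: g_def act_identity_rotation)
    have "\<bar>x' $ k\<bar> \<le> M" "\<bar>y $ k\<bar> \<le> M"
      using M[of i x'] M[of j y] x' y that \<open>S \<subseteq> I\<close> component_le_norm_cart order_trans by blast+
    moreover have "\<bar>(x - y) $ k\<bar> \<le> dist x y"
      unfolding dist_norm by (rule component_le_norm_cart)
    ultimately show "R \<le> dist x y"
      using x'(2) by (simp add: L_def axis_def)
  qed
  ultimately show "\<exists>g. motion I (\<lambda>i. region (P i)) g \<and> (\<forall>i\<in>S. \<forall>j\<in>I - S.
      R \<le> setdist (act (g i 1) ` region (P i)) (act (g j 1) ` region (P j)))"
    by blast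
qed

section \<open>Some piece has nothing to its right\<close>

definition left_of :: "(int \<times> int) set \<Rightarrow> (int \<times> int) set \<Rightarrow> bool" where
  "left_of A B \<longleftrightarrow> (\<exists>a b r. (a, r) \<in> A \<and> (b, r) \<in> B \<and> a < b)"

definition row_convex :: "(int \<times> int) set \<Rightarrow> bool" where
  "row_convex C \<longleftrightarrow> (\<forall>a b x r. (a, r) \<in> C \<longrightarrow> (b, r) \<in> C \<longrightarrow> a \<le> x \<longrightarrow> x \<le> b \<longrightarrow> (x, r) \<in> C)"

text \<open>Of connectedness, the left-to-right order only needs that one can climb inside the set from
  each row to the next, up to its highest row.\<close>

definition row_linked :: "(int \<times> int) set \<Rightarrow> bool" where
  "row_linked C \<longleftrightarrow> (\<forall>a b r s t. (a, r) \<in> C \<longrightarrow> (b, s) \<in> C \<longrightarrow> r \<le> t \<longrightarrow> t < s \<longrightarrow>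
     (\<exists>x. (x, t) \<in> C \<and> (x, t + 1) \<in> C))"

lemma row_convexD:
  "row_convex C \<Longrightarrow> (a, r) \<in> C \<Longrightarrow> (b, r) \<in> C \<Longrightarrow> a \<le> x \<Longrightarrow> x \<le> b \<Longrightarrow> (x, r) \<in> C"
  unfolding row_convex_def by blast

lemma row_linkedD:
  "row_linked C \<Longrightarrow> (a, r) \<in> C \<Longrightarrow> (b, s) \<in> C \<Longrightarrow> r \<le> t \<Longrightarrow> t < s \<Longrightarrow>
    \<exists>x. (x, t) \<in> C \<and> (x, t + 1) \<in> C"
  unfolding row_linked_def by blast

lemma disjoint_convex_rows_ordered:
  assumes "row_convex A" "row_convex B" "A \<inter> B = {}"
    and "(a, r) \<in> A" "(b, r) \<in> B" "a < b" "(a', r) \<in> A" "(b', r) \<in> B"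
  shows "a' < b'"
proof (rule ccontr)
  assume "\<not> a' < b'"
  have "(a', r) \<notin> B" "(b, r) \<notin> A" using assms by auto
  then have "a' < b" using row_convexD[of A a r a' b] assms by force
  then have "(a', r) \<in> B" using row_convexD[of B b' r b a'] assms \<open>\<not> a' < b'\<close> by force
  with \<open>(a', r) \<notin> B\<close> show False ..
qed

text \<open>Both sets step vertically from row \<open>t\<close> to row \<open>t + 1\<close>. The columns of these two steps are
  ordered in row \<open>t\<close>, and the same columns then order row \<open>t + 1\<close>.\<close>

lemma left_of_persists_upwards:
  assumes "row_convex A" "row_convex B" "A \<inter> B = {}" "row_linked A" "row_linked B"
    and r: "(a, r) \<in> A" "(b, r) \<in> B" "a < b" and s: "(a', s) \<in> A" "(b', s) \<in> B" and "r \<le> s"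
  shows "a' < b'"
proof -
  have "\<exists>a b. (a, t) \<in> A \<and> (b, t) \<in> B \<and> a < b" if "r \<le> t" "t \<le> s" for t
    using that
  proof (induction t rule: int_ge_induct)
    case base
    then show ?case using r by blast
  next
    case (step t)
    then obtain a0 b0 where t: "(a0, t) \<in> A" "(b0, t) \<in> B" "a0 < b0" by auto
    obtain x where x: "(x, t) \<in> A" "(x, t + 1) \<in> A"
      using row_linkedD[OF assms(4) r(1) s(1), of t] step by auto
    obtain y where y: "(y, t) \<in> B" "(y, t + 1) \<in> B"
      using row_linkedD[OF assms(5) r(2) s(2), of t] step by auto
    have "x < y" using disjoint_convex_rows_ordered[OF assms(1-3) t x(1) y(1)] .
    then show ?case using x y by blast
  qed
  then obtain a0 b0 where "(a0, s) \<in> A" "(b0, s) \<in> B" "a0 < b0" using \<open>r \<le> s\<close> by blast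
  then show ?thesis using disjoint_convex_rows_ordered[OF assms(1-3)] s by blast
qed

lemma left_of_antisym:
  assumes "row_convex A" "row_convex B" "A \<inter> B = {}" "row_linked A" "row_linked B"
  shows "\<not> (left_of A B \<and> left_of B A)"
proof
  assume "left_of A B \<and> left_of B A"
  then obtain a b r a' b' s where "(a, r) \<in> A" "(b, r) \<in> B" "a < b"
      "(a', s) \<in> A" "(b', s) \<in> B" "b' < a'"
    unfolding left_of_def by blast
  moreover from this have "r \<le> s \<Longrightarrow> a' < b'"
    using left_of_persists_upwards[OF assms] by blast
  moreover from calculation have "s \<le> r \<Longrightarrow> b < a"
    using left_of_persists_upwards[of B A] assms by blast
  ultimately show False by linarith
qed

text \<open>Let \<open>m\<close> have the lowest top row. Whatever shares a row with \<open>m\<close> also reaches the top row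
  of \<open>m\<close>, and there everything to the left of \<open>m\<close> is to the left of everything to the right of \<open>m\<close>.
  So, given a rightmost element \<open>y\<close> of the others, adding \<open>m\<close> does no harm: either \<open>y\<close> is not to
  the left of \<open>m\<close> and stays rightmost, or nothing can be to the right of \<open>m\<close>, because it would be
  to the right of \<open>y\<close> too.\<close>

lemma exists_rightmost:
  fixes T :: "'i \<Rightarrow> (int \<times> int) set"
  assumes "finite J" "J \<noteq> {}"
    and "\<And>i. i \<in> J \<Longrightarrow> finite (T i)" "\<And>i. i \<in> J \<Longrightarrow> T i \<noteq> {}" "\<And>i. i \<in> J \<Longrightarrow> row_linked (T i)"
    and "\<And>i j. i \<in> J \<Longrightarrow> j \<in> J \<Longrightarrow> i \<noteq> j \<Longrightarrow> T i \<inter> T j = {}"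
    and "\<And>i j. i \<in> J \<Longrightarrow> j \<in> J \<Longrightarrow> i \<noteq> j \<Longrightarrow> \<not> (left_of (T i) (T j) \<and> left_of (T j) (T i))"
  shows "\<exists>i\<in>J. \<forall>j\<in>J. j \<noteq> i \<longrightarrow> \<not> left_of (T i) (T j)"
  using assms
proof (induction J rule: finite_psubset_induct)
  case (psubset J)
  note fin = psubset.prems(2) and ne = psubset.prems(3) and linked = psubset.prems(4)
    and disj = psubset.prems(5) and antisym = psubset.prems(6)
  define top_row where "top_row = (\<lambda>i. Max (snd ` T i))"
  obtain m where m: "m \<in> J" "\<And>i. i \<in> J \<Longrightarrow> top_row m \<le> top_row i"
    using ex_is_arg_min_if_finite[OF \<open>finite J\<close> \<open>J \<noteq> {}\<close>, of top_row]
    by (auto simp: is_arg_min_linorder)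
  have top_mem: "\<exists>x. (x, top_row i) \<in> T i" if "i \<in> J" for i
  proof -
    have "top_row i \<in> snd ` T i"
      using Max_in[of "snd ` T i"] fin[OF that] ne[OF that] by (simp add: top_row_def)
    then show ?thesis by auto
  qed
  have top_ge: "r \<le> top_row i" if "i \<in> J" "(x, r) \<in> T i" for i x r
    using Max_ge[of "snd ` T i" r] fin[OF that(1)] imageI[OF that(2), of snd]
    by (simp add: top_row_def)
  have meets_top_row: "\<exists>y. (y, top_row m) \<in> T i"
    if i: "i \<in> J" "(x, r) \<in> T i" and "(z, r) \<in> T m" for i x r z
  proof -
    have "r \<le> top_row m" using top_ge[OF m(1)] that by blast
    moreover obtain w where "(w, top_row i) \<in> T i" using top_mem i by blast
    ultimately show ?thesis
      using row_linkedD[OF linked[OF i(1)] i(2), of w "top_row i" "top_row m"] m(2)[OF i(1)]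
      by (cases "top_row m = top_row i") auto
  qed
  show ?case
  proof (cases "J = {m}")
    case True
    then show ?thesis by blast
  next
    case False
    then have "J - {m} \<subset> J" "J - {m} \<noteq> {}" using m(1) by auto
    then have "\<exists>i\<in>J - {m}. \<forall>j\<in>J - {m}. j \<noteq> i \<longrightarrow> \<not> left_of (T i) (T j)"
      using psubset.prems by (intro psubset.IH) auto
    then obtain y where y: "y \<in> J" "y \<noteq> m"
      and ymax: "\<And>j. j \<in> J \<Longrightarrow> j \<noteq> m \<Longrightarrow> j \<noteq> y \<Longrightarrow> \<not> left_of (T y) (T j)" by blast
    show ?thesis
    proof (cases "left_of (T y) (T m)")
      case False
      then show ?thesis using y ymax by blast
    next
      case True
      have "\<not> left_of (T m) (T z)" if z: "z \<in> J" "z \<noteq> m" for z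
      proof
        assume mz: "left_of (T m) (T z)"
        obtain q where q: "(q, top_row m) \<in> T m" using top_mem m by blast
        obtain p where p: "(p, top_row m) \<in> T y"
          using True meets_top_row[OF y(1)] unfolding left_of_def by blast
        obtain w where w: "(w, top_row m) \<in> T z"
          using mz meets_top_row[OF z(1)] unfolding left_of_def by blast
        have "\<not> left_of (T m) (T y)" "\<not> left_of (T z) (T m)"
          using antisym[OF y(1) m(1) y(2)] antisym[OF z(1) m(1) z(2)] True mz by auto
        then have "\<not> q < p" "\<not> w < q" using p q w unfolding left_of_def by blast+
        moreover have "p \<noteq> q" "w \<noteq> q"
          using disj[OF y(1) m(1) y(2)] disj[OF z(1) m(1) z(2)] p q w by auto
        ultimately have "p < w" by linarith
        then have "left_of (T y) (T z)" using p w unfolding left_of_def by blast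
        moreover have "z \<noteq> y" using antisym[OF y(1) m(1) y(2)] True mz by blast
        ultimately show False using ymax z by blast
      qed
      then show ?thesis using m(1) by blast
    qed
  qed
qed

section \<open>Gaps in small polyominoes\<close>

definition row_hull :: "(int \<times> int) set \<Rightarrow> (int \<times> int) set" where
  "row_hull C = {(x, r). \<exists>a b. a \<le> x \<and> x \<le> b \<and> (a, r) \<in> C \<and> (b, r) \<in> C}"

definition row_gaps :: "(int \<times> int) set \<Rightarrow> (int \<times> int) set" where
  "row_gaps C = row_hull C - C"

lemma subset_row_hull: "C \<subseteq> row_hull C"
  by (auto simp: row_hull_def)

lemma row_gapsI:
  "(a, r) \<in> C \<Longrightarrow> (b, r) \<in> C \<Longrightarrow> a < x \<Longrightarrow> x < b \<Longrightarrow> (x, r) \<notin> C \<Longrightarrow> (x, r) \<in> row_gaps C"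
  unfolding row_gaps_def row_hull_def by (auto intro: less_imp_le)

lemma row_hull_row: "(x, r) \<in> row_hull C \<Longrightarrow> \<exists>a. (a, r) \<in> C"
  by (auto simp: row_hull_def)

lemma row_convex_row_hull: "row_convex (row_hull C)"
  unfolding row_convex_def row_hull_def by (auto; meson order_trans)

lemma finite_row_hull:
  assumes "finite C"
  shows "finite (row_hull C)"
proof (rule finite_subset)
  show "row_hull C \<subseteq> (\<Union>c\<in>C. \<Union>d\<in>C. {fst c..fst d} \<times> {snd c})"
    by (force simp: row_hull_def)
qed (use assms in auto)

lemma row_linked_row_hull:
  assumes "row_linked C"
  shows "row_linked (row_hull C)"
  unfolding row_linked_def
proof (intro allI impI)
  fix a b r s t
  assume *: "(a, r) \<in> row_hull C" "(b, s) \<in> row_hull C" "r \<le> t" "t < s"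
  obtain a' b' where "(a', r) \<in> C" "(b', s) \<in> C" using row_hull_row * by blast
  from row_linkedD[OF assms this *(3,4)] show "\<exists>x. (x, t) \<in> row_hull C \<and> (x, t + 1) \<in> row_hull C"
    using subset_row_hull by blast
qed

lemma polyomino_crossing:
  assumes "polyomino C" "c \<in> C" "d \<in> C" "Q c" "\<not> Q d"
  obtains a b where "a \<in> C" "b \<in> C" "edge_adjacent a b" "Q a" "\<not> Q b"
proof -
  have "(c, d) \<in> {(a, b). a \<in> C \<and> b \<in> C \<and> edge_adjacent a b}\<^sup>*"
    using assms unfolding polyomino_def by blast
  then have "\<exists>a b. a \<in> C \<and> b \<in> C \<and> edge_adjacent a b \<and> Q a \<and> \<not> Q b"
    using assms(4,5) by (induction rule: rtrancl_induct) auto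
  then show ?thesis using that by blast
qed

text \<open>A path from a cell in row at most \<open>t\<close> to a cell above row \<open>t\<close> contains a step that crosses the
  line between them, and this step is vertical.\<close>

lemma polyomino_row_linked:
  assumes "polyomino C"
  shows "row_linked C"
  unfolding row_linked_def
proof (intro allI impI)
  fix a b r s t :: int
  assume "(a, r) \<in> C" "(b, s) \<in> C" "r \<le> t" "t < s"
  then obtain c d where "c \<in> C" "d \<in> C" "edge_adjacent c d" "snd c \<le> t" "\<not> snd d \<le> t"
    using polyomino_crossing[OF assms, of "(a, r)" "(b, s)" "\<lambda>c. snd c \<le> t"] by (metis not_less snd_conv)
  moreover from this have "snd c = t" "snd d = t + 1" "fst c = fst d"
    unfolding edge_adjacent_def by arith+
  ultimately show "\<exists>x. (x, t) \<in> C \<and> (x, t + 1) \<in> C" by (metis prod.collapse)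
qed

lemma card_swap_image: "card (prod.swap ` C) = card C"
  by (rule card_image) (auto simp: inj_on_def)

lemma polyomino_swap:
  assumes "polyomino C"
  shows "polyomino (prod.swap ` C)"
proof -
  let ?E = "{(a, b). a \<in> C \<and> b \<in> C \<and> edge_adjacent a b}"
  let ?E' = "{(a, b). a \<in> prod.swap ` C \<and> b \<in> prod.swap ` C \<and> edge_adjacent a b}"
  have "(prod.swap c, prod.swap d) \<in> ?E'\<^sup>*" if "(c, d) \<in> ?E\<^sup>*" for c d
    using that
  proof (induction rule: rtrancl_induct)
    case (step d e)
    then have "(prod.swap d, prod.swap e) \<in> ?E'" by (auto simp: edge_adjacent_def)
    with step.IH show ?case by (rule rtrancl_into_rtrancl)
  qed simp
  then show ?thesis using assms unfolding polyomino_def by blast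
qed

lemma polyomino_column_linked:
  assumes "polyomino C" "(r, a) \<in> C" "(s, b) \<in> C" "r \<le> t" "t < s"
  shows "\<exists>y. (t, y) \<in> C \<and> (t + 1, y) \<in> C"
  using row_linkedD[OF polyomino_row_linked[OF polyomino_swap[OF assms(1)]], of a r b s t] assms(2-)
  by force

text \<open>The U pentomino with cavity \<open>(x, y)\<close>, open upwards for \<open>s = -1\<close> and downwards for \<open>s = 1\<close>.\<close>

definition u_shape :: "int \<Rightarrow> int \<Rightarrow> int \<Rightarrow> (int \<times> int) set" where
  "u_shape x y s = {(x - 1, y), (x + 1, y), (x - 1, y + s), (x, y + s), (x + 1, y + s)}"

text \<open>A connected set with cells on both sides of the gap \<open>(x, r)\<close> has to cross column \<open>x\<close> in
  another row. This requires horizontal steps between the columns \<open>x - 1\<close>, \<open>x\<close> and \<open>x + 1\<close>. With the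
  two cells beside the gap that already makes five cells, so the two steps lie in one row and
  there are no further cells. Connectedness then leaves no freedom for the remaining
  coordinates.\<close>

lemma row_gap_imp_u_shape:
  assumes "polyomino C" "card C \<le> 5" "(x, r) \<in> row_gaps C"
  obtains s where "s = 1 \<or> s = -1" "C = u_shape x r s"
proof -
  have fin: "finite C" using assms(1) by (simp add: polyomino_def)
  obtain a b where ab: "(a, r) \<in> C" "(b, r) \<in> C" "a < x" "x < b" and gap: "(x, r) \<notin> C"
    using assms(3) unfolding row_gaps_def row_hull_def
    by (auto simp: order_le_less)
  obtain y where y: "(x - 1, y) \<in> C" "(x, y) \<in> C"
    using polyomino_column_linked[OF assms(1) ab(1,2), of "x - 1"] ab by auto
  obtain y' where y': "(x, y') \<in> C" "(x + 1, y') \<in> C"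
    using polyomino_column_linked[OF assms(1) ab(1,2), of "x"] ab by auto
  have "y \<noteq> r" "y' \<noteq> r" using y y' gap by auto
  have "y' = y"
  proof (rule ccontr)
    assume "y' \<noteq> y"
    let ?X = "{(a, r), (b, r), (x - 1, y), (x, y), (x, y'), (x + 1, y')}"
    have "card ?X = 6"
      using ab \<open>y \<noteq> r\<close> \<open>y' \<noteq> r\<close> \<open>y' \<noteq> y\<close> by auto
    moreover have "?X \<subseteq> C"
      using ab y y' by auto
    ultimately show False using card_mono[OF fin, of ?X] assms(2) by linarith
  qed
  let ?Y = "{(a, r), (b, r), (x - 1, y), (x, y), (x + 1, y)}"
  have "card ?Y = 5"
    using ab \<open>y \<noteq> r\<close> by auto
  moreover have "?Y \<subseteq> C"
    using ab y y' \<open>y' = y\<close> by auto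
  moreover from calculation have "card C \<le> card ?Y" using assms(2) by linarith
  ultimately have C: "C = ?Y"
    using card_seteq[OF fin, of ?Y] by blast
  have "\<not> a < x - 1"
    using polyomino_column_linked[OF assms(1) ab(1) y(1), of a] ab \<open>y \<noteq> r\<close>
    unfolding C by auto
  then have "a = x - 1" using ab(3) by linarith
  moreover have "\<not> x + 1 < b"
    using polyomino_column_linked[OF assms(1) y'(2) ab(2), of "b - 1"] ab \<open>y \<noteq> r\<close>
    unfolding C by auto
  then have "b = x + 1" using ab(4) by linarith
  moreover have "y = r + 1" if "r < y"
    using row_linkedD[OF polyomino_row_linked[OF assms(1)] ab(1) y(1), of r] that
    unfolding C by auto
  moreover have "y = r - 1" if "y < r"
    using row_linkedD[OF polyomino_row_linked[OF assms(1)] y(1) ab(1), of "r - 1"] that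
    unfolding C by auto
  ultimately show ?thesis
    using that[of 1] that[of "-1"] C \<open>y \<noteq> r\<close> by (cases "r < y") (auto simp: u_shape_def)
qed

lemma row_gaps_u_shape:
  assumes "s = 1 \<or> s = -1"
  shows "row_gaps (u_shape x y s) = {(x, y)}"
proof (rule equalityI; rule subsetI)
  fix c assume "c \<in> row_gaps (u_shape x y s)"
  then obtain p q a b where c: "c = (p, q)" "(p, q) \<notin> u_shape x y s" "a \<le> p" "p \<le> b"
    and ab: "(a, q) \<in> u_shape x y s" "(b, q) \<in> u_shape x y s"
    by (auto simp: row_gaps_def row_hull_def)
  have "x - 1 \<le> a" "b \<le> x + 1" "q = y \<or> q = y + s"
    using ab by (auto simp: u_shape_def)
  then have "p = x - 1 \<or> p = x \<or> p = x + 1" using c by arith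
  then show "c \<in> {(x, y)}"
    using \<open>q = y \<or> q = y + s\<close> c(1,2) by (auto simp: u_shape_def)
next
  fix c assume "c \<in> {(x, y)}"
  then show "c \<in> row_gaps (u_shape x y s)"
    using assms by (auto simp: u_shape_def intro!: row_gapsI[of "x - 1" y _ "x + 1"])
qed

section \<open>Plugged cavities\<close>

locale small_polyominoes =
  fixes I :: "nat set" and P :: "nat \<Rightarrow> (int \<times> int) set"
  assumes poly: "i \<in> I \<Longrightarrow> polyomino (P i)"
    and small: "i \<in> I \<Longrightarrow> card (P i) \<le> 5"
    and disjoint: "i \<in> I \<Longrightarrow> j \<in> I \<Longrightarrow> i \<noteq> j \<Longrightarrow> P i \<inter> P j = {}"
begin

text \<open>As only an upright or inverted U has a row gap, \<open>j\<close> is then such a U, and \<open>k\<close> occupies its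
  cavity.\<close>

definition plugged :: "nat \<Rightarrow> nat \<Rightarrow> bool" where
  "plugged j k \<longleftrightarrow> j \<in> I \<and> k \<in> I \<and> row_gaps (P j) \<inter> P k \<noteq> {}"

lemma pluggedE:
  assumes "plugged j k"
  obtains x y s where "s = 1 \<or> s = -1" "P j = u_shape x y s" "(x, y) \<in> P k"
    "j \<in> I" "k \<in> I" "j \<noteq> k" "u_shape x y s \<inter> P k = {}" "row_gaps (P j) = {(x, y)}"
proof -
  obtain x y where xy: "(x, y) \<in> row_gaps (P j)" "(x, y) \<in> P k" "j \<in> I" "k \<in> I"
    using assms unfolding plugged_def by auto
  then have "j \<noteq> k" by (auto simp: row_gaps_def)
  obtain s where s: "s = 1 \<or> s = -1" "P j = u_shape x y s"
    using row_gap_imp_u_shape[OF poly small xy(1)] xy(3) by blast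
  show ?thesis
    using that[OF s xy(2-4) \<open>j \<noteq> k\<close>] disjoint[OF xy(3,4) \<open>j \<noteq> k\<close>] s row_gaps_u_shape[OF s(1)]
    by auto
qed

lemma plug_unique: "plugged j k \<Longrightarrow> plugged j l \<Longrightarrow> k = l"
  by (metis Int_iff disjoint empty_iff insert_iff pluggedE prod.inject)

text \<open>If the plug of a U is itself a U with a plugged cavity, then one arm of each lies in the cavity
  of the other: an arm of the plug is between the arms of \<open>j\<close>, so its own cavity is at an arm of
  \<open>j\<close>.\<close>

lemma plugged_chain:
  assumes "plugged j k" "plugged k l"
  shows "l = j"
proof -
  obtain x y s where j: "s = 1 \<or> s = -1" "P j = u_shape x y s" "(x, y) \<in> P k" "j \<in> I"
      "u_shape x y s \<inter> P k = {}"
    using pluggedE[OF assms(1)] by metis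
  obtain x' y' s' where k: "s' = 1 \<or> s' = -1" "P k = u_shape x' y' s'" "(x', y') \<in> P l" "l \<in> I"
    using pluggedE[OF assms(2)] by metis
  have "(x - 1, y) \<notin> P k" "(x + 1, y) \<notin> P k" "(x - 1, y) \<in> P j" "(x + 1, y) \<in> P j"
    using j(2,5) by (auto simp: u_shape_def)
  moreover have "(x' - 1, y' + s') \<in> P k" "(x', y' + s') \<in> P k" "(x' + 1, y' + s') \<in> P k"
    by (simp_all add: k(2) u_shape_def)
  moreover have "(x, y) \<in> {(x' - 1, y'), (x' + 1, y'), (x' - 1, y' + s'), (x', y' + s'), (x' + 1, y' + s')}"
    using j(3) by (simp add: k(2) u_shape_def)
  ultimately have "(x', y') \<in> P j" by auto
  then show ?thesis using disjoint[OF j(4) k(4)] k(3) by blast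
qed

text \<open>The plug of the cavity \<open>(x, y)\<close> could only get to the rows of the back of the U by stepping from
  row \<open>y\<close> to row \<open>y + s\<close> in a column \<open>w\<close> beyond the arms. Then the arm between \<open>w\<close> and \<open>x\<close> sits in
  a row gap of the plug, so the plug is a U around that arm. Such a U avoids the first U only if
  it opens the other way, and then it has no cell in row \<open>y + s\<close>.\<close>

lemma plug_stays_outside:
  assumes D: "polyomino D" "card D \<le> 5" "(x, y) \<in> D" "u_shape x y s \<inter> D = {}"
    and s: "s = 1 \<or> s = -1" and "(z, r) \<in> D"
  shows "s * (r - y) \<le> 0"
proof (rule ccontr)
  assume "\<not> ?thesis"
  then have "\<exists>w. (w, y) \<in> D \<and> (w, y + s) \<in> D"
    using s row_linkedD[OF polyomino_row_linked[OF D(1)] D(3) assms(6), of y]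
      row_linkedD[OF polyomino_row_linked[OF D(1)] assms(6) D(3), of "y - 1"]
    by auto
  then obtain w where w: "(w, y) \<in> D" "(w, y + s) \<in> D" by blast
  then have "w \<notin> {x - 1, x, x + 1}" using D(4) by (auto simp: u_shape_def)
  then consider "w < x - 1" | "w > x + 1" by force
  then show False
  proof cases
    case 1
    moreover have "(x - 1, y) \<notin> D" using D(4) by (auto simp: u_shape_def)
    ultimately have "(x - 1, y) \<in> row_gaps D"
      using row_gapsI[OF w(1) D(3)] by auto
    then obtain s' where s': "s' = 1 \<or> s' = -1" "D = u_shape (x - 1) y s'"
      using row_gap_imp_u_shape[OF D(1,2)] by blast
    then have "(x, y + s') \<in> D" by (simp add: u_shape_def)
    then have "s' \<noteq> s" using D(4) by (auto simp: u_shape_def)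
    then show False using w(2) s s' by (auto simp: u_shape_def)
  next
    case 2
    moreover have "(x + 1, y) \<notin> D" using D(4) by (auto simp: u_shape_def)
    ultimately have "(x + 1, y) \<in> row_gaps D"
      using row_gapsI[OF D(3) w(1)] by auto
    then obtain s' where s': "s' = 1 \<or> s' = -1" "D = u_shape (x + 1) y s'"
      using row_gap_imp_u_shape[OF D(1,2)] by blast
    then have "(x, y + s') \<in> D" by (simp add: u_shape_def)
    then have "s' \<noteq> s" using D(4) by (auto simp: u_shape_def)
    then show False using w(2) s s' by (auto simp: u_shape_def)
  qed
qed

text \<open>Two disjoint U pieces side by side have cavities at least three columns apart, whereas a
  piece with a row gap is itself a U and its two cells in that row are only two columns apart.\<close>

lemma plugged_same_row_unique:
  assumes i: "plugged i k" "P i = u_shape x y s" "(x, y) \<in> P k"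
    and j: "plugged j k" "P j = u_shape x' y s" "(x', y) \<in> P k"
    and s: "s = 1 \<or> s = -1" and "x \<le> x'"
  shows "i = j"
proof (rule ccontr)
  assume "i \<noteq> j"
  have I: "i \<in> I" "j \<in> I" "k \<in> I" "i \<noteq> k" using pluggedE[OF i(1)] pluggedE[OF j(1)] by metis+
  have "P i \<inter> P j = {}" "P i \<inter> P k = {}"
    using disjoint I \<open>i \<noteq> j\<close> by auto
  moreover have "(x + 1, y) \<in> P i" "(x' - 1, y) \<in> P j" "(x' + 1, y) \<in> P j"
    using i(2) j(2) by (simp_all add: u_shape_def)
  ultimately have "x' \<noteq> x" "x' \<noteq> x + 1" "x' - 1 \<noteq> x + 1" and "(x + 1, y) \<notin> P k"
    using j(3) by (blast, blast, metis disjoint_iff, blast)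
  then have "(x + 1, y) \<in> row_gaps (P k)"
    using \<open>x \<le> x'\<close> by (intro row_gapsI[OF i(3) j(3)]) auto
  then obtain s' where "s' = 1 \<or> s' = -1" "P k = u_shape (x + 1) y s'"
    using row_gap_imp_u_shape[OF poly[OF I(3)] small[OF I(3)]] by blast
  then show False using j(3) \<open>x' \<noteq> x\<close> \<open>x' - 1 \<noteq> x + 1\<close> by (auto simp: u_shape_def)
qed

definition cluster :: "nat \<Rightarrow> nat set" where
  "cluster i = insert i {j. plugged j i}"

definition block :: "nat \<Rightarrow> (int \<times> int) set" where
  "block i = (\<Union>j\<in>cluster i. row_hull (P j))"

lemma cluster_subset: "i \<in> I \<Longrightarrow> cluster i \<subseteq> I"
  by (auto simp: cluster_def plugged_def)

lemma cluster_hull_meets_center: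
  assumes "i \<in> I" "j \<in> cluster i"
  shows "row_hull (P j) \<inter> row_hull (P i) \<noteq> {}"
proof -
  have "P i \<noteq> {}" using poly[OF assms(1)] by (simp add: polyomino_def)
  then show ?thesis
    using assms(2) subset_row_hull unfolding cluster_def plugged_def row_gaps_def by blast
qed

text \<open>Every hull in the block meets the hull of the central piece, so a climb between two of them
  takes place in the first, in the second or in the centre.\<close>

lemma block_row_linked:
  assumes "i \<in> I"
  shows "row_linked (block i)"
  unfolding row_linked_def
proof (intro allI impI)
  fix a b r s t :: int
  assume *: "(a, r) \<in> block i" "(b, s) \<in> block i" "r \<le> t" "t < s"
  have linked: "row_linked (row_hull (P j))" if "j \<in> cluster i" for j
    using that cluster_subset[OF assms] poly polyomino_row_linked row_linked_row_hull by blast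
  have i: "i \<in> cluster i" by (simp add: cluster_def)
  obtain j k where j: "j \<in> cluster i" "(a, r) \<in> row_hull (P j)"
    and k: "k \<in> cluster i" "(b, s) \<in> row_hull (P k)"
    using * unfolding block_def by blast
  obtain u p where p: "(u, p) \<in> row_hull (P j)" "(u, p) \<in> row_hull (P i)"
    using cluster_hull_meets_center[OF assms j(1)] by auto
  obtain v q where q: "(v, q) \<in> row_hull (P k)" "(v, q) \<in> row_hull (P i)"
    using cluster_hull_meets_center[OF assms k(1)] by auto
  consider "t < p" | "q \<le> t" | "p \<le> t" "t < q" by linarith
  then have "\<exists>m\<in>cluster i. \<exists>x. (x, t) \<in> row_hull (P m) \<and> (x, t + 1) \<in> row_hull (P m)"
    using row_linkedD[OF linked[OF j(1)] j(2) p(1) \<open>r \<le> t\<close>]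
      row_linkedD[OF linked[OF k(1)] q(1) k(2) _ \<open>t < s\<close>]
      row_linkedD[OF linked[OF i] p(2) q(2)] i j(1) k(1)
    by cases blast+
  then show "\<exists>x. (x, t) \<in> block i \<and> (x, t + 1) \<in> block i"
    unfolding block_def by blast
qed

lemma plugged_rows:
  assumes "plugged j i" "(a, r) \<in> row_hull (P j)"
  obtains x y s where "s = 1 \<or> s = -1" "P j = u_shape x y s" "(x, y) \<in> P i"
    "(x, y) \<in> row_hull (P j)" "r = y \<or> r = y + s"
    "\<forall>z q. (z, q) \<in> row_hull (P i) \<longrightarrow> s * (q - y) \<le> 0"
proof -
  obtain x y s where *: "s = 1 \<or> s = -1" "P j = u_shape x y s" "(x, y) \<in> P i" "i \<in> I"
      "u_shape x y s \<inter> P i = {}" "row_gaps (P j) = {(x, y)}"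
    using pluggedE[OF assms(1)] by metis
  have "(x, y) \<in> row_hull (P j)" using *(6) by (auto simp: row_gaps_def)
  moreover have "r = y \<or> r = y + s"
    using row_hull_row[OF assms(2)] *(2) by (auto simp: u_shape_def)
  moreover have "s * (q - y) \<le> 0" if "(z, q) \<in> row_hull (P i)" for z q
    using row_hull_row[OF that] plug_stays_outside[OF poly[OF *(4)] small[OF *(4)] *(3,5,1)]
    by blast
  ultimately show ?thesis using that * by blast
qed

text \<open>In a row that the centre reaches, every other hull of the block meets the centre in that row,
  namely at the plugged cavity, so their intervals join up. Any other row is the row of the back
  of a U, and two cells of the block in it belong to the same U.\<close>

lemma block_row_convex:
  assumes "i \<in> I"
  shows "row_convex (block i)"
  unfolding row_convex_def
proof (intro allI impI)
  fix a b x r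
  assume *: "(a, r) \<in> block i" "(b, r) \<in> block i" "a \<le> x" "x \<le> b"
  obtain j k where j: "j \<in> cluster i" "(a, r) \<in> row_hull (P j)"
    and k: "k \<in> cluster i" "(b, r) \<in> row_hull (P k)"
    using * unfolding block_def by blast
  have i: "i \<in> cluster i" by (simp add: cluster_def)
  have "\<exists>l\<in>cluster i. (x, r) \<in> row_hull (P l)"
  proof (cases "\<exists>d. (d, r) \<in> row_hull (P i)")
    case True
    then obtain d where d: "(d, r) \<in> row_hull (P i)" by blast
    have common: "\<exists>m. (m, r) \<in> row_hull (P l) \<and> (m, r) \<in> row_hull (P i)"
      if l: "l \<in> cluster i" "(c, r) \<in> row_hull (P l)" for l c
    proof (cases "l = i")
      case False
      then have "plugged l i" using l by (simp add: cluster_def)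
      then obtain u v s where "s = 1 \<or> s = -1" "(u, v) \<in> P i" "(u, v) \<in> row_hull (P l)"
          "r = v \<or> r = v + s" "s * (r - v) \<le> 0"
        using plugged_rows[OF _ l(2)] d by metis
      then show ?thesis using subset_row_hull by auto
    qed (use d in blast)
    obtain m where m: "(m, r) \<in> row_hull (P j)" "(m, r) \<in> row_hull (P i)"
      using common[OF j] by blast
    obtain m' where m': "(m', r) \<in> row_hull (P k)" "(m', r) \<in> row_hull (P i)"
      using common[OF k] by blast
    consider "x \<le> m" | "m' \<le> x" | "m \<le> x" "x \<le> m'" by linarith
    then show ?thesis
      using row_convexD[OF row_convex_row_hull j(2) m(1) \<open>a \<le> x\<close>]
        row_convexD[OF row_convex_row_hull m'(1) k(2) _ \<open>x \<le> b\<close>]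
        row_convexD[OF row_convex_row_hull m(2) m'(2)] i j(1) k(1)
      by cases blast+
  next
    case False
    then have "j \<noteq> i" "k \<noteq> i" using j k by auto
    then have pl: "plugged j i" "plugged k i" using j k by (auto simp: cluster_def)
    obtain u v s where j': "s = 1 \<or> s = -1" "P j = u_shape u v s" "(u, v) \<in> P i"
        "(u, v) \<in> row_hull (P j)" "r = v \<or> r = v + s"
        "\<forall>z q. (z, q) \<in> row_hull (P i) \<longrightarrow> s * (q - v) \<le> 0"
      by (rule plugged_rows[OF pl(1) j(2)]) (rule that; assumption)
    obtain u' v' s' where k': "s' = 1 \<or> s' = -1" "P k = u_shape u' v' s'" "(u', v') \<in> P i"
        "(u', v') \<in> row_hull (P k)" "r = v' \<or> r = v' + s'"
        "\<forall>z q. (z, q) \<in> row_hull (P i) \<longrightarrow> s' * (q - v') \<le> 0"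
      by (rule plugged_rows[OF pl(2) k(2)]) (rule that; assumption)
    have hull: "(u, v) \<in> row_hull (P i)" "(u', v') \<in> row_hull (P i)"
      using j'(3) k'(3) subset_row_hull by blast+
    then have "r = v + s" "r = v' + s'" using False j'(5) k'(5) by auto
    then have "s' = s" "v' = v"
      using j'(1) k'(1) j'(6)[rule_format, OF hull(2)]
        k'(6)[rule_format, OF hull(1)] by auto
    then have "j = k"
      using plugged_same_row_unique[OF pl(1) j'(2,3) pl(2), of u']
        plugged_same_row_unique[OF pl(2) _ _ pl(1) j'(2,3), of u'] k' j'(1)
      by (metis linorder_linear)
    then show ?thesis
      using row_convexD[OF row_convex_row_hull j(2)] k *(3,4) by blast
  qed
  then show "(x, r) \<in> block i" unfolding block_def by blast
qed

text \<open>The clusters of the centres are to partition the pieces. A plugged U belongs to the cluster of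
  its plug and is no centre. Only if two U pieces plug each other, something has to break the tie,
  and the smaller index is taken.\<close>

definition center :: "nat \<Rightarrow> bool" where
  "center i \<longleftrightarrow> i \<in> I \<and> (\<forall>k. plugged i k \<longrightarrow> plugged k i \<and> i < k)"

lemma in_some_cluster:
  assumes "j \<in> I"
  shows "\<exists>i. center i \<and> j \<in> cluster i"
proof (cases "center j")
  case True
  then show ?thesis by (auto simp: cluster_def)
next
  case False
  then obtain k where k: "plugged j k" "\<not> (plugged k j \<and> j < k)"
    using assms unfolding center_def by blast
  have "center k"
    unfolding center_def
  proof (intro conjI allI impI)
    show "k \<in> I" using k(1) by (simp add: plugged_def)
    fix l assume "plugged k l"
    moreover from this have "l = j" using plugged_chain k(1) by blast
    moreover have "j \<noteq> k" using pluggedE[OF k(1)] by metis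
    ultimately show "plugged l k" "k < l" using k by auto
  qed
  then show ?thesis using k by (auto simp: cluster_def)
qed

text \<open>Two U pieces with the same cavity would share the cells on both sides of it.\<close>

lemma hulls_meet:
  assumes "i \<in> I" "j \<in> I" "row_hull (P i) \<inter> row_hull (P j) \<noteq> {}"
  shows "i = j \<or> plugged i j \<or> plugged j i"
proof (rule ccontr)
  assume neg: "\<not> ?thesis"
  then have disj: "P i \<inter> P j = {}" using disjoint assms by blast
  obtain x y where "(x, y) \<in> row_hull (P i)" "(x, y) \<in> row_hull (P j)" using assms by auto
  then have "(x, y) \<in> row_gaps (P i)" "(x, y) \<in> row_gaps (P j)"
    using neg disj assms unfolding plugged_def row_gaps_def by blast+
  then obtain s s' where "P i = u_shape x y s" "P j = u_shape x y s'"
    using row_gap_imp_u_shape poly small assms by metis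
  then show False using disj by (auto simp: u_shape_def)
qed

lemma clusters_separate:
  assumes "center i" "center k" "m \<in> cluster i" "m' \<in> cluster k"
    and "m = m' \<or> plugged m m' \<or> plugged m' m"
  shows "i = k"
proof -
  have sole_center: "l = m" if "m \<in> cluster l" "center l" "center m" for m l
    using that unfolding cluster_def center_def by (metis insert_iff mem_Collect_eq order_less_asym)
  have eq: "l = l'" if "m \<in> cluster l" "m \<in> cluster l'" "center l" "center l'" for m l l'
    using that sole_center plug_unique unfolding cluster_def
    by (metis insert_iff mem_Collect_eq)
  have "i = k" if "plugged m m'" "center i" "center k" "m \<in> cluster i" "m' \<in> cluster k" for i k m m'
  proof (cases "center m")
    case True
    then have "m = i" using sole_center that by blast
    then have "m' \<in> cluster i" using True that(1) unfolding center_def cluster_def by blast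
    then show ?thesis using eq that by blast
  next
    case False
    then have "plugged m i" using that unfolding cluster_def by blast
    then have "m' = i" using plug_unique that by blast
    then show ?thesis using sole_center that by blast
  qed
  then show ?thesis using assms eq by metis
qed

lemma blocks_disjoint:
  assumes "center i" "center k" "i \<noteq> k"
  shows "block i \<inter> block k = {}"
proof (rule ccontr)
  assume "block i \<inter> block k \<noteq> {}"
  then obtain m m' where m: "m \<in> cluster i" "m' \<in> cluster k"
      "row_hull (P m) \<inter> row_hull (P m') \<noteq> {}"
    unfolding block_def by blast
  moreover have "m \<in> I" "m' \<in> I"
    using m cluster_subset assms unfolding center_def by blast+
  ultimately show False using hulls_meet clusters_separate assms by blast
qed

lemma exists_rightmost_cluster:
  assumes "finite I" "I \<noteq> {}"
  obtains i where "i \<in> I" "\<And>m j. m \<in> cluster i \<Longrightarrow> j \<in> I - cluster i \<Longrightarrow> \<not> left_of (P m) (P j)"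
proof -
  let ?J = "{i. center i}"
  have sub: "?J \<subseteq> I" by (auto simp: center_def)
  have mem: "P m \<subseteq> block i" if "m \<in> cluster i" for m i
    using that subset_row_hull unfolding block_def by blast
  have "\<exists>i\<in>?J. \<forall>j\<in>?J. j \<noteq> i \<longrightarrow> \<not> left_of (block i) (block j)"
  proof (rule exists_rightmost)
    show "finite ?J" using sub assms finite_subset by blast
    show "?J \<noteq> {}" using in_some_cluster assms(2) by blast
  next
    fix i assume "i \<in> ?J"
    then have i: "i \<in> I" using sub by blast
    then have "finite (cluster i)" using cluster_subset assms finite_subset by blast
    moreover have "finite (P m)" if "m \<in> cluster i" for m
      using poly cluster_subset i that unfolding polyomino_def by blast
    ultimately show "finite (block i)"
      unfolding block_def using finite_row_hull by blast
    show "block i \<noteq> {}"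
      using mem[of i i] poly[OF i] unfolding polyomino_def cluster_def by blast
    show "row_linked (block i)" using block_row_linked i .
  next
    fix i j assume ij: "i \<in> ?J" "j \<in> ?J" "i \<noteq> j"
    then show "block i \<inter> block j = {}" using blocks_disjoint by blast
    then show "\<not> (left_of (block i) (block j) \<and> left_of (block j) (block i))"
      using left_of_antisym block_row_convex block_row_linked ij sub by blast
  qed
  then obtain i where i: "center i"
    and best: "\<And>j. center j \<Longrightarrow> j \<noteq> i \<Longrightarrow> \<not> left_of (block i) (block j)" by blast
  have "\<not> left_of (P m) (P j)" if "m \<in> cluster i" "j \<in> I - cluster i" for m j
  proof -
    have "j \<in> I" using that by simp
    then obtain k where k: "center k" "j \<in> cluster k" using in_some_cluster by blast
    moreover have "k \<noteq> i" using k that by blast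
    ultimately show ?thesis
      using best mem[OF that(1)] mem[of j k] unfolding left_of_def by blast
  qed
  then show ?thesis using that i sub by blast
qed

text \<open>A cluster with a second piece \<open>j\<close> consists of upright or inverted U pieces and the plug \<open>i\<close>. A
  piece with a column gap is a U on its side, so it is not one of the former. It is no plug
  either: the middle cell of its back has neighbours above and below, one of which would lie in the
  back of the plugged U, and each of its other cells has a horizontal neighbour, which would lie
  in an arm of the plugged U.\<close>

lemma column_gap_not_in_cluster:
  assumes "i \<in> I" "j \<in> cluster i" "j \<noteq> i" "l = i \<or> l = j"
  shows "row_gaps (prod.swap ` P l) = {}"
proof (rule ccontr)
  assume "row_gaps (prod.swap ` P l) \<noteq> {}"
  then obtain p q where pq: "(q, p) \<in> row_gaps (prod.swap ` P l)" by auto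
  have pl: "plugged j i" using assms by (simp add: cluster_def)
  obtain x y s where *: "s = 1 \<or> s = -1" "P j = u_shape x y s" "(x, y) \<in> P i" "j \<in> I"
      "u_shape x y s \<inter> P i = {}"
    using pluggedE[OF pl] by metis
  have "l \<in> I" using assms *(4) by blast
  then obtain s' where s': "s' = 1 \<or> s' = -1" and sw: "prod.swap ` P l = u_shape q p s'"
    using row_gap_imp_u_shape[OF polyomino_swap[OF poly] _ pq] small
    by (metis card_swap_image)
  have "P l = prod.swap ` u_shape q p s'" unfolding sw[symmetric] by (simp add: image_image)
  then have l: "P l = {(p, q - 1), (p, q + 1), (p + s', q - 1), (p + s', q), (p + s', q + 1)}"
    by (auto simp: u_shape_def)
  show False
  proof (cases "l = i")
    case True
    have "(x - 1, y) \<notin> P i" "(x + 1, y) \<notin> P i" "(x, y + s) \<notin> P i"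
      using *(5) by (auto simp: u_shape_def)
    moreover have "(p, q - 1) \<in> P i" "(p, q + 1) \<in> P i" "(p + s', q - 1) \<in> P i" "(p + s', q + 1) \<in> P i"
      using l True by auto
    moreover have "x = p \<and> y = q - 1 \<or> x = p \<and> y = q + 1 \<or>
        x = p + s' \<and> y = q - 1 \<or> x = p + s' \<and> y = q \<or> x = p + s' \<and> y = q + 1"
      using *(3) l True by auto
    ultimately show False using *(1) s' by auto
  next
    case False
    then have "l = j" using assms(4) by blast
    then have "(p, q) \<notin> P j" "(p, q - 1) \<in> P j" "(p, q + 1) \<in> P j" using l s' by auto
    then have "q - 1 = y \<or> q - 1 = y + s" "q + 1 = y \<or> q + 1 = y + s"
      using *(2) by (auto simp: u_shape_def)
    then show False using *(1) by auto
  qed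
qed

end

section \<open>Separating the system\<close>

theorem theorem1:
  fixes n :: nat and P :: "nat \<Rightarrow> (int \<times> int) set"
  assumes "n \<ge> 2"
    and "grid_aligned_configuration {1..n} P"
    and "\<forall>i\<in>{1..n}. card (P i) \<le> 5"
  shows "\<not> interlocked {1..n} (\<lambda>i. region (P i))"
proof -
  let ?I = "{1..n}"
  have poly: "\<And>i. i \<in> ?I \<Longrightarrow> polyomino (P i)"
    and interiors: "disjoint_interiors ?I (\<lambda>i. region (P i))"
    using assms(2) by (auto simp: grid_aligned_configuration_def)
  have disj: "P i \<inter> P j = {}" if "i \<in> ?I" "j \<in> ?I" "i \<noteq> j" for i j
    using interiors that
    by (intro disjoint_cells_if_disjoint_interiors) (auto simp: disjoint_interiors_def pairwise_def)
  interpret small_polyominoes ?I P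
    by unfold_locales (use poly disj assms(3) in auto)
  have fin: "\<And>i. i \<in> ?I \<Longrightarrow> finite (P i)" and ne: "\<And>i. i \<in> ?I \<Longrightarrow> P i \<noteq> {}"
    using poly by (auto simp: polyomino_def)
  have two: "1 \<in> ?I" "2 \<in> ?I" using assms(1) by auto
  have I: "?I \<noteq> {}" "\<And>i. ?I \<noteq> {i}"
    using two by (blast, metis singletonD one_eq_numeral_iff num.distinct(1))
  have "\<exists>S. S \<noteq> {} \<and> S \<subset> ?I \<and> separable ?I (\<lambda>i. region (P i)) S"
  proof (cases "\<exists>c\<in>?I. row_gaps (prod.swap ` P c) \<noteq> {}")
    case False
    \<comment> \<open>Swapping the coordinates turns columns into rows, and the slide goes upwards.\<close>
    define Q where "Q = (\<lambda>i. prod.swap ` P i)"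
    have convex: "row_convex (Q i)" if "i \<in> ?I" for i
    proof -
      have "row_hull (Q i) = Q i"
        using False that subset_row_hull unfolding Q_def row_gaps_def by blast
      then show ?thesis using row_convex_row_hull by metis
    qed
    have linked: "row_linked (Q i)" if "i \<in> ?I" for i
      using polyomino_row_linked[OF polyomino_swap[OF poly[OF that]]] by (simp add: Q_def)
    have Q_disj: "Q i \<inter> Q j = {}" if "i \<in> ?I" "j \<in> ?I" "i \<noteq> j" for i j
      using disj[OF that] by (auto simp: Q_def)
    have "\<exists>i\<in>?I. \<forall>j\<in>?I. j \<noteq> i \<longrightarrow> \<not> left_of (Q i) (Q j)"
    proof (rule exists_rightmost)
      show "finite (Q i)" "Q i \<noteq> {}" if "i \<in> ?I" for i
        using fin[OF that] ne[OF that] by (auto simp: Q_def)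
      show "\<not> (left_of (Q i) (Q j) \<and> left_of (Q j) (Q i))"
        if "i \<in> ?I" "j \<in> ?I" "i \<noteq> j" for i j
        using left_of_antisym convex linked Q_disj that by blast
    qed (use I(1) linked Q_disj in auto)
    then obtain i where i: "i \<in> ?I" "\<And>j. j \<in> ?I \<Longrightarrow> j \<noteq> i \<Longrightarrow> \<not> left_of (Q i) (Q j)" by blast
    have "separable ?I (\<lambda>i. region (P i)) {i}"
    proof (rule separable_by_sliding[where k = 2, OF _ fin ne interiors])
      fix i' j c d
      assume *: "i' \<in> {i}" "j \<in> ?I - {i}" "c \<in> P i'" "d \<in> P j"
        and "\<And>l. l \<noteq> 2 \<Longrightarrow> coord c l = coord d l"
      from this(5)[of 1] have "fst c = fst d" by (simp add: coord_def)
      moreover have "(snd c, fst c) \<in> Q i" "(snd d, fst d) \<in> Q j"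
        using * by (force simp: Q_def)+
      ultimately show "\<not> coord c 2 < coord d 2"
        using i(2)[of j] * by (auto simp: coord_def left_of_def)
    qed (use i in auto)
    then show ?thesis using i(1) I(2) by blast
  next
    case True
    then obtain c where c: "c \<in> ?I" "row_gaps (prod.swap ` P c) \<noteq> {}" by blast
    obtain i where i: "i \<in> ?I"
      and unblocked: "\<And>m j. m \<in> cluster i \<Longrightarrow> j \<in> ?I - cluster i \<Longrightarrow> \<not> left_of (P m) (P j)"
      using exists_rightmost_cluster[OF _ I(1)] by auto
    have "cluster i \<noteq> ?I"
    proof
      assume "cluster i = ?I"
      then obtain j where "j \<in> cluster i" "j \<noteq> i" using I(2)[of i] i by blast
      moreover from this have "c \<noteq> i" using column_gap_not_in_cluster[OF i] c(2) by blast
      moreover have "c \<in> cluster i" using \<open>cluster i = ?I\<close> c by blast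
      ultimately show False using column_gap_not_in_cluster[OF i, of c c] c(2) by blast
    qed
    then have "cluster i \<subset> ?I" using cluster_subset[OF i] by blast
    moreover have "separable ?I (\<lambda>i. region (P i)) (cluster i)"
    proof (rule separable_by_sliding[where k = 1, OF _ fin ne interiors])
      fix m j c d
      assume *: "m \<in> cluster i" "j \<in> ?I - cluster i" "c \<in> P m" "d \<in> P j"
        and "\<And>l. l \<noteq> 1 \<Longrightarrow> coord c l = coord d l"
      from this(5)[of 2] have "snd c = snd d" by (simp add: coord_def)
      then show "\<not> coord c 1 < coord d 1"
        using unblocked[OF *(1,2)] *(3,4) unfolding left_of_def coord_def
        by (metis prod.collapse)
    qed (use cluster_subset[OF i] in auto)
    moreover have "cluster i \<noteq> {}" unfolding cluster_def by blast
    ultimately show ?thesis by blast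
  qed
  then show ?thesis unfolding interlocked_def by blast
qed

end
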